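(* Let $d\ge 2$ be an integer, $r=\lfloor\frac{d+1}2\rfloor$, and for $n\ge0$ let $$x_n=x_n^{(d)}=\sum_{n_1+\dots+n_d=n}\frac{(n!)^2}{(n_1!\cdots n_d!)^2}$$ (sum over nonnegative integers). There are polynomials $Q_0,\dots,Q_r$ such that the sequence $(x_n)_n$ satisfies, for all $n\ge 0$, the recurrence $$\sum_{k=0}^rQ_k(n+k)\,x_{n+k}=0$$ and the initial conditions $$\sum_{k=0}^mQ_{r-m+k}(k)\,x_k=0\quad\text{for }0\le m\le r-1,$$ and moreover: 1. $\deg(Q_k)=d-1$ for all $0\le k\le r$. 2. $Q_k(-n-r+k)=(-1)^{d-1}Q_k(n)$ for all $0\le k\le r$. 3. The leading coefficient of $Q_k(n)$ is $(-1)^{r-k}e_{r-k}(S_d)$. 4. $Q_r(n)=n^{d-1}$. 5. For $0\le k\le r-2$, $\prod_{j=1}^{r-k-1}(n+j)^2$ divides $Q_k(n)$. 6. If $d$ is odd, then $Q_0(n)=(-1)^re_r(S_d)\prod_{j=1}^{r-1}(n+j)^2$. If $d$ is even, then $Q_0(n)=(-1)^re_r(S_d)\,(n+\tfrac r2)\prod_{j=1}^{r-1}(n+j)^2$. 7. $Q_{r-1}(n)=-\sum_{j=0}^{d-1}(d-j)\binom{d+2}{j}n^j=-\left[(n+1)^{d+1}(d-2n)+n^{d+1}(d+2+2n)\right]$.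
   Context: $S_d=\{k^2:\ 1\le k\le d,\ k\equiv d\pmod 2\}$, and $e_m(S_d)$ denotes the $m$-th elementary symmetric sum of the elements of $S_d$ (with $e_0=1$). *)

theory Defs
  imports "HOL-Computational_Algebra.Computational_Algebra"
begin

definition Sset :: "nat \<Rightarrow> nat set" where
  "Sset d = {k ^ 2 | k. 1 \<le> k \<and> k \<le> d \<and> k mod 2 = d mod 2}"

definition elem_sym :: "nat \<Rightarrow> nat set \<Rightarrow> nat" where
  "elem_sym m A = (\<Sum>B | B \<subseteq> A \<and> card B = m. \<Prod>B)"

(* The list ns is the tuple (n_1, ..., n_d), with n_i = ns ! (i - 1). *)
definition xseq :: "nat \<Rightarrow> nat \<Rightarrow> rat" where
  "xseq d n = (\<Sum>ns | length ns = d \<and> sum_list ns = n.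
              (fact n) ^ 2 / (\<Prod>i<d. fact (ns ! i)) ^ 2)"

end

theory Submission
  imports Defs
begin

text \<open>
  With $f = \sum_n z^n / (n!)^2$ one has $x_n = (n!)^2 [z^n] f^d$, so a recurrence for $x_n$ is a
  linear differential equation for $f^d$ in disguise. Write $\theta = z\, d/dz$ and $g = \theta f$.
  Since $\theta g = z f$, the series
  $G_m = d (d-1) \cdots (d-m+1)\, f^{d-m} g^m$ satisfy
  $$G_{m+1} = \theta G_m - m (d+1-m)\, z\, G_{m-1}, \qquad G_0 = f^d, \qquad G_{d+1} = 0 .$$
  Thus $f^d$ is annihilated by the operator $L_{d+1}$, where $L_0 = 1$, $L_1 = \theta$ and
  $L_{m+1} = \theta L_m - c_m z L_{m-1}$ with $c_m = m (d+1-m)$. Normal ordering gives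
  $L_{d+1} = \sum_k z^k P_k(\theta)$ with $P_0 = \theta^{d+1}$ and $P_k = 0$ for $2k > d+1$. Comparing
  coefficients of $z^n$, multiplying by $(n!)^2$ and dividing by $n^2$ turns $L_{d+1} f^d = 0$ into the
  recurrence with $Q_r(n) = n^{d-1}$ and $Q_{r-k}(n) = P_k(n) \prod_{j=1}^{k-1} (n+j)^2$ for $k \ge 1$.
  The recurrence at $1 \le n < r$ and the vanishing of $Q_r(0)$ are the initial conditions. The
  divisibility statement is visible in this formula, and everything else is a property of $P_k$.

  Symmetry: $\theta \mapsto -\theta$, $z \mapsto z$ extends to an anti-automorphism, because it
  preserves $\theta z = z (\theta + 1)$. It reverses the order of the weights
  $c_1, \ldots, c_d$, which form a palindrome, so it maps $L_{d+1}$ to $(-1)^{d+1} L_{d+1}$; in terms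
  of the $P_k$ this reads $P_k(-t-k) = (-1)^{d+1} P_k(t)$ (\<open>poly_sympow_reflect\<close>).

  Leading coefficients: at top order $\theta$ and $z$ commute, so the leading coefficients of the
  $P_k$ are the coefficients of the polynomial $D_{d+1}$ with $D_{m+1} = x D_m - c_m D_{m-1}$, the
  characteristic polynomial of the Sylvester-Kac matrix. Its roots are
  $d, d-2, \ldots, -d$ (\<open>tridiag_sympow_root\<close>), hence it is $\prod_{s \in S_d} (x^2 - s)$,
  with an extra factor $x$ if $d$ is even, and elementary symmetric sums appear
  (\<open>coeff_sympow_top\<close>). They are positive, which gives the degrees. The polynomial $P_r$ is
  constant if $d$ is odd; if $d$ is even it is linear and the symmetry places its root at
  $-r/2$. Finally $P_1$ obeys a first-order recursion in $m$ that has a closed solution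
  (\<open>poly_continuant_1_closed\<close>).
\<close>

section \<open>Noncommutative continuants in normal order\<close>

text \<open>
  The polynomial \<open>continuant c m k\<close> is the coefficient $P$ of $z^k P(\theta)$ in the normal form
  of the operator $L_m$ given by $L_{m+1} = \theta L_m - c_m z L_{m-1}$. The factor $\theta + k$ in the
  recursion comes from $\theta z^k = z^k (\theta + k)$.
\<close>
fun continuant :: "(nat \<Rightarrow> 'a::comm_ring_1) \<Rightarrow> nat \<Rightarrow> nat \<Rightarrow> 'a poly" where
  "continuant c 0 k = (if k = 0 then 1 else 0)"
| "continuant c (Suc 0) k = (if k = 0 then [:0, 1:] else 0)"
| "continuant c (Suc (Suc m)) k = [:of_nat k, 1:] * continuant c (Suc m) k
     - (if k = 0 then 0 else smult (c (Suc m)) (continuant c m (k - 1)))"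

lemma continuant_0: "continuant c m 0 = monom 1 m"
  by (induction c m "0 :: nat" rule: continuant.induct) (simp_all add: monom_altdef)

lemma continuant_eq_0: "m < 2 * k \<Longrightarrow> continuant c m k = 0"
  by (induction c m k rule: continuant.induct) auto

text \<open>Each factor $z$ in $L_m$ uses up two of the $m$ steps, and only the other $m - 2k$ supply a $\theta$.\<close>
lemma degree_continuant: "degree (continuant c m k) \<le> m - 2 * k"
proof (induction c m k rule: continuant.induct)
  case (3 c m k)
  show ?case
  proof (cases "Suc m < 2 * k")
    case True
    have "degree (smult (c (Suc m)) (continuant c m (k - 1))) \<le> m - 2 * (k - 1)" if "k \<noteq> 0"
      using degree_smult_le 3(2)[OF that] by (rule order_trans)
    then show ?thesis
      using True by (auto simp: continuant_eq_0)
  next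
    case False
    have "degree ([:of_nat k, 1:] * continuant c (Suc m) k) \<le> 1 + (Suc m - 2 * k)"
      by (rule order_trans[OF degree_mult_le]) (use 3(1) in \<open>auto intro!: add_mono\<close>)
    moreover have "degree (smult (c (Suc m)) (continuant c m (k - 1))) \<le> m - 2 * (k - 1)" if "k \<noteq> 0"
      using degree_smult_le 3(2)[OF that] by (rule order_trans)
    ultimately show ?thesis
      using False by (auto intro!: degree_diff_le simp: Suc_diff_le)
  qed
qed auto

text \<open>
  On power series, $z^i P(\theta)$ sends $[z^{n-i}]$ to $[z^n]$ and multiplies it by $P(n-i)$; the
  right-hand side is therefore the $n$-th coefficient of $L_m G_0$.
\<close>
lemma fps_nth_continuant_recurrence:
  fixes G :: "nat \<Rightarrow> 'a::comm_ring_1 fps"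
  assumes G1: "G 1 = fps_X * fps_deriv (G 0)"
    and G_rec: "\<And>m. G (Suc (Suc m)) = fps_X * fps_deriv (G (Suc m)) - fps_const (c (Suc m)) * fps_X * G m"
  shows "fps_nth (G m) n
    = (\<Sum>i\<le>n. poly (continuant c m i) (of_nat (n - i)) * fps_nth (G 0) (n - i))"
proof (induction m arbitrary: n rule: induct_nat_012)
  case 0
  have "(\<Sum>i\<le>n. poly (continuant c 0 i) (of_nat (n - i)) * fps_nth (G 0) (n - i))
      = (\<Sum>i\<le>n. if i = 0 then fps_nth (G 0) n else 0)"
    by (intro sum.cong) auto
  then show ?case by simp
next
  case 1
  have "(\<Sum>i\<le>n. poly (continuant c (Suc 0) i) (of_nat (n - i)) * fps_nth (G 0) (n - i))
      = (\<Sum>i\<le>n. if i = 0 then of_nat n * fps_nth (G 0) n else 0)"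
    by (intro sum.cong) auto
  moreover have "fps_nth (G 1) n = of_nat n * fps_nth (G 0) n"
    unfolding G1 by (cases n) simp_all
  ultimately show ?case by simp
next
  case (ge2 m)
  let ?t = "\<lambda>m i. poly (continuant c m i) (of_nat (n - i)) * fps_nth (G 0) (n - i)"
  have theta: "fps_nth (fps_X * fps_deriv (G (Suc m))) n = of_nat n * fps_nth (G (Suc m)) n"
    by (cases n) simp_all
  have shift: "fps_nth (fps_X * G m) n = (\<Sum>i\<le>n. if i = 0 then 0 else
      poly (continuant c m (i - 1)) (of_nat (n - i)) * fps_nth (G 0) (n - i))"
    by (cases n) (simp_all add: ge2.IH(1) sum.atMost_Suc_shift del: sum.atMost_Suc)
  have "fps_nth (G (Suc (Suc m))) n
      = of_nat n * fps_nth (G (Suc m)) n - c (Suc m) * fps_nth (fps_X * G m) n"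
    by (simp only: G_rec fps_sub_nth theta mult.assoc fps_mult_left_const_nth)
  also have "\<dots> = (\<Sum>i\<le>n. of_nat n * ?t (Suc m) i - c (Suc m) * (if i = 0 then 0 else
      poly (continuant c m (i - 1)) (of_nat (n - i)) * fps_nth (G 0) (n - i)))"
    unfolding ge2.IH(2) shift by (simp only: sum_distrib_left sum_subtractf)
  also have "\<dots> = (\<Sum>i\<le>n. ?t (Suc (Suc m)) i)"
  proof (intro sum.cong refl)
    fix i assume "i \<in> {..n}"
    then obtain j where "n = i + j"
      by (auto simp: le_iff_add)
    then show "of_nat n * ?t (Suc m) i - c (Suc m) * (if i = 0 then 0 else
        poly (continuant c m (i - 1)) (of_nat (n - i)) * fps_nth (G 0) (n - i)) = ?t (Suc (Suc m)) i"
      by (simp add: algebra_simps)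
  qed
  finally show ?case .
qed

lemma poly_continuant_rec:
  "poly (continuant c (Suc (Suc m)) k) t = (of_nat k + t) * poly (continuant c (Suc m) k) t
     - (if k = 0 then 0 else c (Suc m) * poly (continuant c m (k - 1)) t)"
  by (simp add: algebra_simps)

text \<open>
  The defining recursion peels factors off the left end of the continuant; this one peels them off
  the right end. Moving $\theta$ and $z$ to the right of $z^k P(\theta)$ multiplies $P$ by $t$ in the
  first case and shifts its argument by one in the second, as $P(\theta) z = z P(\theta + 1)$.
\<close>
lemma continuant_right_rec:
  "poly (continuant c (Suc (Suc m)) k) t = t * poly (continuant (\<lambda>j. c (Suc j)) (Suc m) k) t
     - (if k = 0 then 0 else c 1 * poly (continuant (\<lambda>j. c (Suc (Suc j))) m (k - 1)) (t + 1))"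
proof (induction m arbitrary: k rule: induct_nat_012)
  case 0
  show ?case by simp
next
  case 1
  show ?case by (cases "k = 0") (auto simp: algebra_simps le_Suc_eq)
next
  case (ge2 m)
  show ?case
  proof (cases k)
    case 0
    then show ?thesis
      by (simp add: continuant_0 poly_monom del: continuant.simps)
  next
    case k: (Suc k')
    show ?thesis
      unfolding poly_continuant_rec[of c "Suc (Suc m)"] ge2.IH
        poly_continuant_rec[of "\<lambda>j. c (Suc j)" "Suc m"] poly_continuant_rec[of "\<lambda>j. c (Suc (Suc j))" m]
      by (simp add: k algebra_simps del: continuant.simps)
  qed
qed

text \<open>
  The anti-automorphism $\theta \mapsto -\theta$, $z \mapsto z$ sends $z^k P(\theta)$ to
  $P(-\theta) z^k = z^k P(-\theta - k)$ and exchanges left and right recursion, hence reverses the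
  weights $c_1, \ldots, c_{m-1}$.
\<close>
lemma continuant_reflect:
  "poly (continuant c m k) (- t - of_nat k) = (- 1) ^ m * poly (continuant (\<lambda>j. c (m - j)) m k) t"
proof (induction m arbitrary: k t rule: induct_nat_012)
  case (ge2 m)
  have arg: "- t - of_nat k = - (t + 1) - (of_nat (k - 1) :: 'a)" if "k \<noteq> 0"
    using that by (simp add: of_nat_diff)
  have "poly (continuant c (Suc (Suc m)) k) (- t - of_nat k)
      = - t * poly (continuant c (Suc m) k) (- t - of_nat k)
        - (if k = 0 then 0 else c (Suc m) * poly (continuant c m (k - 1)) (- t - of_nat k))"
    by (simp add: algebra_simps)
  also have "\<dots> = - t * ((- 1) ^ Suc m * poly (continuant (\<lambda>j. c (Suc m - j)) (Suc m) k) t)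
        - (if k = 0 then 0 else c (Suc m) *
             ((- 1) ^ m * poly (continuant (\<lambda>j. c (m - j)) m (k - 1)) (t + 1)))"
    unfolding ge2.IH(2) by (simp add: arg del: of_nat_diff flip: ge2.IH(1))
  also have "\<dots> = (- 1) ^ Suc (Suc m) * poly (continuant (\<lambda>j. c (Suc (Suc m) - j)) (Suc (Suc m)) k) t"
    unfolding continuant_right_rec by (simp add: algebra_simps)
  finally show ?case .
qed simp_all

section \<open>Leading coefficients of continuants\<close>

text \<open>
  This is the image of the continuant when $\theta$ becomes a commuting variable and $z$ becomes $1$: the
  characteristic polynomial of the tridiagonal matrix with zero diagonal and products
  $c_1, \ldots, c_{m-1}$ of opposite off-diagonal entries.
\<close>
fun tridiag_poly :: "(nat \<Rightarrow> 'a::comm_ring_1) \<Rightarrow> nat \<Rightarrow> 'a poly" where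
  "tridiag_poly c 0 = 1"
| "tridiag_poly c (Suc 0) = [:0, 1:]"
| "tridiag_poly c (Suc (Suc m)) = [:0, 1:] * tridiag_poly c (Suc m) - smult (c (Suc m)) (tridiag_poly c m)"

lemma degree_tridiag_poly: "degree (tridiag_poly c m) \<le> m"
proof (induction c m rule: tridiag_poly.induct)
  case (3 c m)
  have "degree ([:0, 1:] * tridiag_poly c (Suc m)) \<le> 1 + Suc m"
    by (rule order_trans[OF degree_mult_le]) (use 3(1) in simp)
  moreover have "degree (smult (c (Suc m)) (tridiag_poly c m)) \<le> m"
    using degree_smult_le 3(2) by (rule order_trans)
  ultimately show ?case
    by (auto intro!: degree_diff_le)
qed simp_all

lemma coeff_tridiag_poly_top: "poly.coeff (tridiag_poly c m) m = 1"
proof (induction c m rule: tridiag_poly.induct)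
  case (3 c m)
  have "poly.coeff (tridiag_poly c m) (Suc (Suc m)) = 0"
    using degree_tridiag_poly[of c m] by (intro coeff_eq_0) simp
  then show ?case using 3 by simp
qed simp_all

lemma coeff_linear_mult: "poly.coeff ([:a, 1:] * p) (Suc n) = a * poly.coeff p (Suc n) + poly.coeff p n"
  for p :: "'a::comm_ring_1 poly"
  by simp

text \<open>
  The lower terms produced by commuting $\theta$ past $z$ have smaller degree, so the top
  coefficient does not see the noncommutativity.
\<close>
lemma coeff_continuant:
  "2 * k \<le> m \<Longrightarrow> poly.coeff (continuant c m k) (m - 2 * k) = poly.coeff (tridiag_poly c m) (m - 2 * k)"
proof (induction m arbitrary: k rule: induct_nat_012)
  case (ge2 m)
  show ?case
  proof (cases k)
    case 0
    then show ?thesis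
      by (simp only: continuant_0 mult_0_right diff_zero coeff_tridiag_poly_top) simp
  next
    case k: (Suc k')
    have IH: "poly.coeff (continuant c m k') (m - 2 * k') = poly.coeff (tridiag_poly c m) (m - 2 * k')"
      using ge2 k by simp
    show ?thesis
    proof (cases "2 * k \<le> Suc m")
      case True
      define n where "n = Suc m - 2 * k"
      have n: "m - 2 * k' = Suc n" "Suc (Suc m) - 2 * k = Suc n"
        using True k by (simp_all add: n_def)
      have "poly.coeff (continuant c (Suc m) k) (Suc n) = 0"
        using degree_continuant[of c "Suc m" k] by (intro coeff_eq_0) (simp add: n_def)
      moreover have "poly.coeff (continuant c (Suc m) k) n = poly.coeff (tridiag_poly c (Suc m)) n"
        unfolding n_def using True by (rule ge2.IH(2))
      ultimately show ?thesis
        using IH unfolding n continuant.simps tridiag_poly.simps coeff_diff coeff_linear_mult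
        by (simp add: k)
    next
      case False
      then have n: "m - 2 * k' = 0" "Suc (Suc m) - 2 * k = 0"
        using k by simp_all
      have "continuant c (Suc m) k = 0"
        using False by (intro continuant_eq_0) simp
      then show ?thesis
        using IH unfolding n continuant.simps tridiag_poly.simps by (simp add: k)
    qed
  qed
qed simp_all

section \<open>The Sylvester-Kac weights\<close>

definition sympow_weight :: "nat \<Rightarrow> nat \<Rightarrow> rat" where
  "sympow_weight d j = of_nat (j * (d + 1 - j))"

lemma sympow_weight_reflect: "sympow_weight d (d + 1 - j) = sympow_weight d j"
  by (cases "j \<le> d + 1") (simp_all add: sympow_weight_def)

lemma poly_sympow_reflect:
  "poly (continuant (sympow_weight d) (d + 1) k) (- t - of_nat k)
     = (- 1) ^ (d + 1) * poly (continuant (sympow_weight d) (d + 1) k) t"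
  by (subst continuant_reflect) (simp only: sympow_weight_reflect)

text \<open>
  For $x = d - 2j$ the polynomial $G = (1+t)^{d-j} (1-t)^j$ satisfies $(1 - t^2) G' = (x - d t) G$, and
  comparing coefficients shows that $m!\, [t^m] G$ obeys the recursion of the tridiagonal
  polynomials evaluated at $x$. Since $G$ has degree $d$, the value with index $d + 1$ is zero.
\<close>
lemma tridiag_sympow_root:
  assumes "j \<le> d"
  shows "poly (tridiag_poly (sympow_weight d) (d + 1)) (of_nat d - 2 * of_nat j) = 0"
proof -
  define x where "x = (of_nat d - 2 * of_nat j :: rat)"
  define u v where "u = [:1, 1 :: rat:]" and "v = [:1, - 1 :: rat:]"
  define G where "G = u ^ (d - j) * v ^ j"
  have power_deriv: "p * pderiv (p ^ n) = smult (of_nat n) (p ^ n * pderiv p)" for p :: "rat poly" and n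
  proof (cases n)
    case (Suc m)
    show ?thesis by (simp only: Suc pderiv_power_Suc) (simp add: mult.assoc)
  qed simp
  have "[:1, 0, - 1:] * pderiv G = (u * v) * pderiv G"
    by (simp add: u_def v_def)
  also have "\<dots> = v * (u * pderiv (u ^ (d - j))) * v ^ j + u * (v * pderiv (v ^ j)) * u ^ (d - j)"
    by (simp add: G_def pderiv_mult algebra_simps)
  also have "\<dots> = (smult (of_nat (d - j)) v - smult (of_nat j) u) * G"
    unfolding power_deriv by (simp add: G_def u_def[THEN arg_cong, of pderiv] v_def[THEN arg_cong, of pderiv]
      pderiv_pCons one_pCons[symmetric] algebra_simps)
  also have "smult (of_nat (d - j)) v - smult (of_nat j) u = [:x, - of_nat d:]"
    using assms by (simp add: u_def v_def x_def of_nat_diff)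
  finally have ode: "[:1, 0, - 1:] * pderiv G = [:x, - of_nat d:] * G" .
  have G_rec: "of_nat (Suc (Suc m)) * poly.coeff G (Suc (Suc m))
      = x * poly.coeff G (Suc m) - (of_nat d - of_nat m) * poly.coeff G m" for m
  proof -
    have "poly.coeff ([:1, 0, - 1:] * pderiv G) (Suc m) = poly.coeff ([:x, - of_nat d:] * G) (Suc m)"
      by (simp only: ode)
    then show ?thesis
      by (cases m) (simp_all add: coeff_pderiv algebra_simps)
  qed
  have coeff_0: "poly.coeff G 0 = 1"
    by (simp add: G_def u_def v_def coeff_mult_0 coeff_0_power)
  have coeff_1: "poly.coeff G 1 = x"
    using arg_cong[OF ode, of "\<lambda>p. poly.coeff p 0"] coeff_0 by (simp add: coeff_pderiv)
  have "m \<le> d + 1 \<longrightarrow> poly (tridiag_poly (sympow_weight d) m) x = fact m * poly.coeff G m" for m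
  proof (induction m rule: induct_nat_012)
    case (ge2 m)
    show ?case
    proof
      assume m: "Suc (Suc m) \<le> d + 1"
      have weight: "sympow_weight d (Suc m) = of_nat (Suc m) * (of_nat d - of_nat m)"
        using m by (simp add: sympow_weight_def of_nat_diff distrib_right)
      have "poly (tridiag_poly (sympow_weight d) (Suc (Suc m))) x
          = fact (Suc m) * (x * poly.coeff G (Suc m) - (of_nat d - of_nat m) * poly.coeff G m)"
        using ge2 m by (simp add: weight algebra_simps)
      also have "\<dots> = fact (Suc (Suc m)) * poly.coeff G (Suc (Suc m))"
        unfolding G_rec[symmetric] fact_Suc[of "Suc m"] by (simp add: algebra_simps)
      finally show "poly (tridiag_poly (sympow_weight d) (Suc (Suc m))) x
          = fact (Suc (Suc m)) * poly.coeff G (Suc (Suc m))" .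
    qed
  qed (use coeff_0 coeff_1 in auto)
  moreover have "degree G \<le> (d - j) + j"
    unfolding G_def u_def v_def
    by (intro order_trans[OF degree_mult_le] add_mono order_trans[OF degree_power_le]) simp_all
  then have "poly.coeff G (d + 1) = 0"
    using assms by (intro coeff_eq_0) simp
  ultimately show ?thesis
    unfolding x_def by simp
qed

text \<open>
  The map $j \mapsto (d - 2j)^2$ enumerates $S_d$ without repetition when $2j < d$; the zero that $2j = d$
  would contribute for even $d$ is left out.
\<close>
lemma Sset_eq_image: "Sset d = (\<lambda>j. (d - 2 * j) ^ 2) ` {..<(d + 1) div 2}"
proof -
  have "{k. 1 \<le> k \<and> k \<le> d \<and> k mod 2 = d mod 2} = (\<lambda>j. d - 2 * j) ` {..<(d + 1) div 2}"
  proof (intro Set.set_eqI iffI)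
    fix k assume "k \<in> {k. 1 \<le> k \<and> k \<le> d \<and> k mod 2 = d mod 2}"
    then have k: "1 \<le> k" "k \<le> d" "even (d - k)"
      by (auto simp: mod2_eq_if split: if_splits)
    then obtain j where "d - k = 2 * j" by blast
    then show "k \<in> (\<lambda>j. d - 2 * j) ` {..<(d + 1) div 2}"
      using k by (intro image_eqI[of _ _ j]) auto
  next
    fix k assume "k \<in> (\<lambda>j. d - 2 * j) ` {..<(d + 1) div 2}"
    then obtain j where "k = d - 2 * j" "2 * j < d" by auto
    then show "k \<in> {k. 1 \<le> k \<and> k \<le> d \<and> k mod 2 = d mod 2}"
      by (auto simp: mod2_eq_if)
  qed
  then have "(\<lambda>k. k\<^sup>2) ` {k. 1 \<le> k \<and> k \<le> d \<and> k mod 2 = d mod 2}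
      = (\<lambda>j. (d - 2 * j)\<^sup>2) ` {..<(d + 1) div 2}"
    by (simp add: image_image)
  then show ?thesis
    by (simp add: Sset_def setcompr_eq_image)
qed

lemma finite_Sset: "finite (Sset d)"
  by (simp add: Sset_eq_image)

lemma card_Sset: "card (Sset d) = (d + 1) div 2"
proof -
  have "inj_on (\<lambda>j. (d - 2 * j) ^ 2) {..<(d + 1) div 2}"
    by (intro inj_onI) (auto simp: power2_eq_iff_nonneg)
  then show ?thesis
    unfolding Sset_eq_image by (simp add: card_image)
qed

lemma elem_sym_Sset_pos:
  assumes "k \<le> (d + 1) div 2"
  shows "elem_sym k (Sset d) > 0"
proof -
  obtain B where B: "B \<subseteq> Sset d" "card B = k"
    using assms by (metis card_Sset obtain_subset_with_card_n)
  have "0 \<notin> Sset d"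
    by (auto simp: Sset_def)
  then have "\<Prod>C > 0" if "C \<subseteq> Sset d" for C
    using that by (intro prod_pos) (metis gr0I subsetD)
  then show ?thesis
    unfolding elem_sym_def using B finite_Sset[of d]
    by (intro sum_pos) auto
qed

lemma prod_even_quadratics:
  assumes "finite S"
  shows "(\<Prod>s\<in>S. [:- of_nat s, 0, 1 :: 'a::comm_ring_1:])
     = (\<Sum>B\<in>Pow S. monom ((- 1) ^ card B * of_nat (\<Prod>B)) (2 * (card S - card B)))"
proof -
  have "(\<Prod>s\<in>S. [:- of_nat s, 0, 1 :: 'a:]) = (\<Prod>s\<in>S. [:- of_nat s:] + monom 1 2)"
    by (simp add: monom_altdef power2_eq_square)
  also have "\<dots> = (\<Sum>B\<in>Pow S. (\<Prod>s\<in>B. [:- of_nat s:]) * (\<Prod>s\<in>S - B. monom 1 2))"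
    using assms by (rule prod_add)
  also have "\<dots> = (\<Sum>B\<in>Pow S. monom ((- 1) ^ card B * of_nat (\<Prod>B)) (2 * (card S - card B)))"
  proof (intro sum.cong refl)
    fix B assume "B \<in> Pow S"
    then have B: "B \<subseteq> S" "finite B" using assms by (auto intro: finite_subset)
    have "(\<Prod>s\<in>B. [:- of_nat s:]) = [:(- 1) ^ card B * of_nat (\<Prod>B) :: 'a:]"
      using B(2) by (induction B) (simp_all add: one_pCons algebra_simps)
    then show "(\<Prod>s\<in>B. [:- of_nat s:]) * (\<Prod>s\<in>S - B. monom 1 2)
        = monom ((- 1) ^ card B * of_nat (\<Prod>B) :: 'a) (2 * (card S - card B))"
      by (simp only: prod_constant monom_power card_Diff_subset[OF B(2,1)] power_one)
        (simp add: smult_monom)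
  qed
  finally show ?thesis .
qed

text \<open>
  Both sides are monic of degree $d + 1$ and vanish at the $d + 1$ numbers $d - 2j$. The monomial is
  $x$ for even $d$, where $0$ is one of these numbers, and $1$ for odd $d$.
\<close>
lemma tridiag_sympow_factorization:
  "tridiag_poly (sympow_weight d) (d + 1) = monom 1 (d + 1 - 2 * card (Sset d)) * (\<Prod>s\<in>Sset d. [:- of_nat s, 0, 1:])"
    (is "_ = ?E")
proof -
  have lead: "lead_coeff ?E = 1"
    by (simp add: lead_coeff_mult lead_coeff_prod degree_monom_eq)
  have "?E \<noteq> 0" using lead by (metis leading_coeff_0_iff zero_neq_one)
  then have deg: "degree ?E = d + 1"
    by (subst degree_mult_eq; (subst degree_prod_eq_sum_degree)?)
      (auto simp: degree_monom_eq card_Sset)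
  define A where "A = (\<lambda>j. of_nat d - 2 * of_nat j :: rat) ` {..d}"
  have card_A: "card A = d + 1"
    unfolding A_def by (subst card_image) (auto intro: inj_onI)
  have E_root: "poly ?E z = 0" if zA: "z \<in> A" for z
  proof -
    obtain j where j: "j \<le> d" "z = of_nat d - 2 * of_nat j"
      using zA unfolding A_def by blast
    show ?thesis
    proof (cases "d = 2 * j")
      case True
      then show ?thesis using j by (simp add: card_Sset poly_monom)
    next
      case False
      \<comment> \<open>The roots with indices $j$ and $d - j$ are opposite and share the square in $S_d$.\<close>
      define i where "i = min j (d - j)"
      have i: "i < (d + 1) div 2" and "z = of_nat (d - 2 * i) \<or> z = - of_nat (d - 2 * i)"
        using False j by (auto simp: i_def min_def of_nat_diff)
      then have z: "z\<^sup>2 = of_nat ((d - 2 * i)\<^sup>2)"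
        by (elim disjE) (simp_all only: power2_minus of_nat_power)
      have "(d - 2 * i)\<^sup>2 \<in> Sset d"
        using i by (auto simp: Sset_eq_image)
      moreover have "poly [:- of_nat ((d - 2 * i)\<^sup>2), 0, 1:] z = 0"
        using z by (simp add: power2_eq_square)
      ultimately have "(\<Prod>s\<in>Sset d. poly [:- of_nat s, 0, 1:] z) = 0"
        using finite_Sset by (intro prod_zero) auto
      then show ?thesis
        by (simp only: poly_mult poly_prod mult_zero_right)
    qed
  qed
  have tridiag_root: "poly (tridiag_poly (sympow_weight d) (d + 1)) z = 0" if "z \<in> A" for z
    using that tridiag_sympow_root by (auto simp: A_def)
  show ?thesis
  proof (rule poly_eqI_degree_lead_coeff)
    show "poly.coeff (tridiag_poly (sympow_weight d) (d + 1)) (d + 1) = poly.coeff ?E (d + 1)"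
      unfolding coeff_tridiag_poly_top using lead by (simp only: deg)
    show "poly (tridiag_poly (sympow_weight d) (d + 1)) z = poly ?E z" if "z \<in> A" for z
      using E_root[OF that] tridiag_root[OF that] by (simp only:)
  qed (simp_all only: card_A deg degree_tridiag_poly order_refl)
qed

lemma coeff_sympow_top:
  assumes "k \<le> (d + 1) div 2"
  shows "poly.coeff (continuant (sympow_weight d) (d + 1) k) (d + 1 - 2 * k)
    = (- 1) ^ k * of_nat (elem_sym k (Sset d))"
proof -
  let ?r = "card (Sset d)"
  have k: "2 * k \<le> d + 1" "k \<le> ?r" using assms by (auto simp: card_Sset)
  have r: "2 * ?r \<le> d + 1" by (simp add: card_Sset)
  have "poly.coeff (continuant (sympow_weight d) (d + 1) k) (d + 1 - 2 * k)
      = (\<Sum>B\<in>Pow (Sset d). if card B = k then (- 1) ^ k * of_nat (\<Prod>B) else 0)"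
    unfolding coeff_continuant[OF k(1)] tridiag_sympow_factorization prod_even_quadratics[OF finite_Sset]
      sum_distrib_left mult_monom coeff_sum
  proof (intro sum.cong refl)
    fix B assume "B \<in> Pow (Sset d)"
    then have "card B \<le> ?r" using finite_Sset by (simp add: card_mono)
    then have "d + 1 - 2 * ?r + 2 * (?r - card B) = d + 1 - 2 * k \<longleftrightarrow> card B = k"
      using k r by auto
    then show "poly.coeff (monom (1 * ((- 1) ^ card B * of_nat (\<Prod>B))) (d + 1 - 2 * ?r + 2 * (?r - card B)))
        (d + 1 - 2 * k) = (if card B = k then (- 1) ^ k * of_nat (\<Prod>B) else 0 :: rat)"
      by simp
  qed
  also have "\<dots> = (- 1) ^ k * of_nat (elem_sym k (Sset d))"
    by (simp add: elem_sym_def sum_distrib_left sum.If_cases finite_Sset Pow_def Collect_conj_eq[symmetric]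
        Int_def)
  finally show ?thesis .
qed

lemma degree_sympow:
  assumes "k \<le> (d + 1) div 2"
  shows "degree (continuant (sympow_weight d) (d + 1) k) = d + 1 - 2 * k"
proof (rule antisym[OF degree_continuant le_degree])
  show "poly.coeff (continuant (sympow_weight d) (d + 1) k) (d + 1 - 2 * k) \<noteq> 0"
    unfolding coeff_sympow_top[OF assms] using elem_sym_Sset_pos[OF assms] by simp
qed

section \<open>The coefficient of $z$\<close>

text \<open>
  The left-hand side $p_m$ satisfies $p_{m+1} = (t+1) p_m - c_{m+1} t^m$ with $p_0 = 0$. The first
  summand on the right solves the homogeneous recursion, and the second one is the particular solution
  of the form $t^m$ times a quadratic polynomial in $t$ that makes the sum vanish at $m = 0$.
  For $a = m = d$ the constant term of the quadratic is zero and one more power of $t$ splits off.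
\<close>
lemma poly_continuant_1_closed:
  fixes c :: "nat \<Rightarrow> 'a::comm_ring_1" and a t :: 'a
  assumes "\<And>j. j \<le> m \<Longrightarrow> c j = of_nat j * (a + 1 - of_nat j)"
  shows "poly (continuant c (Suc m) 1) t = - ((t + 1) ^ (m + 1) * (a - 2 * t)
     + t ^ m * (2 * t\<^sup>2 + (2 - a + 2 * of_nat m) * t - (of_nat m + 1) * (a - of_nat m)))"
  using assms
proof (induction m)
  case 0
  show ?case by (simp add: power2_eq_square algebra_simps)
next
  case (Suc m)
  have "poly (continuant c (Suc (Suc m)) 1) t
      = (t + 1) * poly (continuant c (Suc m) 1) t - c (Suc m) * t ^ m"
    unfolding poly_continuant_rec by (simp add: continuant_0 poly_monom add.commute del: continuant.simps)
  also have "\<dots> = (t + 1) * (- ((t + 1) ^ (m + 1) * (a - 2 * t)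
     + t ^ m * (2 * t\<^sup>2 + (2 - a + 2 * of_nat m) * t - (of_nat m + 1) * (a - of_nat m))))
     - (of_nat m + 1) * (a - of_nat m) * t ^ m"
  proof -
    have "c (Suc m) = (of_nat m + 1) * (a - of_nat m)"
      using Suc.prems[of "Suc m"] by (simp add: add.commute)
    moreover note Suc.IH[OF Suc.prems[OF le_SucI]]
    ultimately show ?thesis by (simp only:)
  qed
  also have "\<dots> = - ((t + 1) ^ (Suc m + 1) * (a - 2 * t)
     + t ^ Suc m * (2 * t\<^sup>2 + (2 - a + 2 * of_nat (Suc m)) * t - (of_nat (Suc m) + 1) * (a - of_nat (Suc m))))"
    by (simp add: power2_eq_square algebra_simps)
  finally show ?case .
qed

lemma poly_sympow_1_closed:
  "poly (continuant (sympow_weight d) (d + 1) 1) t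
     = - ((t + 1) ^ (d + 1) * (of_nat d - 2 * t) + t ^ (d + 1) * (of_nat d + 2 + 2 * t))"
proof -
  have "sympow_weight d j = of_nat j * (of_nat d + 1 - of_nat j)" if "j \<le> d" for j
    using that by (simp only: sympow_weight_def of_nat_mult) (simp add: of_nat_diff)
  then have "poly (continuant (sympow_weight d) (Suc d) 1) t = - ((t + 1) ^ (d + 1) * (of_nat d - 2 * t)
     + t ^ d * (2 * t\<^sup>2 + (2 - of_nat d + 2 * of_nat d) * t - (of_nat d + 1) * (of_nat d - of_nat d)))"
    by (rule poly_continuant_1_closed)
  moreover have "t ^ d * (2 * t\<^sup>2 + (2 - of_nat d + 2 * of_nat d) * t - (of_nat d + 1) * (of_nat d - of_nat d))
      = t ^ (d + 1) * (of_nat d + 2 + 2 * t)"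
    by (simp add: power2_eq_square algebra_simps)
  ultimately show ?thesis
    by (simp only: Suc_eq_plus1)
qed

text \<open>
  Expanding $(t+1)^{d+1} (d - 2t)$ gives the coefficients $(d-j) \binom{d+2}{j}$ for all
  $j \le d + 2$. The one with $j = d$ is zero, and the second summand on the right cancels those with
  $j = d + 1$ and $j = d + 2$.
\<close>
lemma sum_shifted_binomial_closed:
  fixes t :: "'a::comm_ring_1"
  shows "(\<Sum>j=0..d - 1. (of_nat d - of_nat j) * of_nat ((d + 2) choose j) * t ^ j)
    = (t + 1) ^ (d + 1) * (of_nat d - 2 * t) + t ^ (d + 1) * (of_nat d + 2 + 2 * t)"
proof -
  let ?a = "\<lambda>j. (of_nat d - of_nat j) * of_nat ((d + 2) choose j) :: 'a"
  have coeff: "?a (Suc i) = of_nat d * of_nat ((d + 1) choose Suc i) - 2 * of_nat ((d + 1) choose i)"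
    if "i \<le> d + 1" for i
  proof -
    have "Suc i * ((d + 1) choose Suc i) = (d + 1 - i) * ((d + 1) choose i)"
      by (metis Suc_times_binomial_add binomial_absorb_comp binomial_absorption add.commute diff_Suc_1 plus_1_eq_Suc)
    then have "of_nat (Suc i * ((d + 1) choose Suc i)) = (of_nat ((d + 1 - i) * ((d + 1) choose i)) :: 'a)"
      by (rule arg_cong)
    then have "of_nat (Suc i) * of_nat ((d + 1) choose Suc i) = (of_nat d + 1 - of_nat i :: 'a) * of_nat ((d + 1) choose i)"
      using that unfolding of_nat_mult by (simp only: of_nat_diff of_nat_add of_nat_1)
    then show ?thesis by (simp add: algebra_simps)
  qed
  have pow: "(t + 1) ^ (d + 1) = (\<Sum>i\<le>d + 1. of_nat ((d + 1) choose i) * t ^ i)"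
    by (simp only: binomial_ring[of t 1] power_one mult_1_right)
  have "(t + 1) ^ (d + 1) * (of_nat d - 2 * t)
     = of_nat d * (\<Sum>i\<le>d + 1. of_nat ((d + 1) choose i) * t ^ i)
       - 2 * t * (\<Sum>i\<le>d + 1. of_nat ((d + 1) choose i) * t ^ i)"
    unfolding pow by (simp only: algebra_simps)
  also have "of_nat d * (\<Sum>i\<le>d + 1. of_nat ((d + 1) choose i) * t ^ i)
      = (\<Sum>i\<le>d + 2. of_nat d * of_nat ((d + 1) choose i) * t ^ i)"
    by (simp add: sum_distrib_left mult.assoc binomial_eq_0 distrib_left)
  also have "2 * t * (\<Sum>i\<le>d + 1. of_nat ((d + 1) choose i) * t ^ i)
      = (\<Sum>i\<le>d + 1. 2 * of_nat ((d + 1) choose i) * t ^ Suc i)"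
    unfolding sum_distrib_left by (intro sum.cong) (simp_all only: power_Suc mult_ac)
  also have "(\<Sum>i\<le>d + 2. of_nat d * of_nat ((d + 1) choose i) * t ^ i)
       - (\<Sum>i\<le>d + 1. 2 * of_nat ((d + 1) choose i) * t ^ Suc i)
      = of_nat d + (\<Sum>i\<le>d + 1. ?a (Suc i) * t ^ Suc i)"
  proof -
    have "(\<Sum>i\<le>d + 2. of_nat d * of_nat ((d + 1) choose i) * t ^ i)
        = of_nat d + (\<Sum>i\<le>d + 1. of_nat d * of_nat ((d + 1) choose Suc i) * t ^ Suc i)"
      using sum.atMost_Suc_shift[of "\<lambda>i. of_nat d * of_nat ((d + 1) choose i) * t ^ i" "d + 1"]
      by (simp del: sum.atMost_Suc binomial_Suc_Suc power_Suc)
    moreover have "(\<Sum>i\<le>d + 1. ?a (Suc i) * t ^ Suc i)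
        = (\<Sum>i\<le>d + 1. of_nat d * of_nat ((d + 1) choose Suc i) * t ^ Suc i)
          - (\<Sum>i\<le>d + 1. 2 * of_nat ((d + 1) choose i) * t ^ Suc i)"
      unfolding sum_subtractf[symmetric]
      by (intro sum.cong refl) (simp only: coeff atMost_iff, simp only: left_diff_distrib)
    ultimately show ?thesis by (simp only: add_diff_eq)
  qed
  also have "\<dots> = (\<Sum>j\<le>d + 2. ?a j * t ^ j)"
    using sum.atMost_Suc_shift[of "\<lambda>j. ?a j * t ^ j" "d + 1"]
    by (simp del: sum.atMost_Suc binomial_Suc_Suc power_Suc)
  also have "\<dots> = (\<Sum>j\<le>d. ?a j * t ^ j) - (of_nat d + 2) * t ^ (d + 1) - 2 * t ^ (d + 2)"
    by (simp add: algebra_simps)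
  also have "(\<Sum>j\<le>d. ?a j * t ^ j) = (\<Sum>j=0..d - 1. ?a j * t ^ j)"
    by (cases d) (simp_all add: atLeast0AtMost)
  finally show ?thesis by (simp add: algebra_simps)
qed

section \<open>Powers of the Bessel series\<close>

text \<open>The series of the modified Bessel function $I_0(2 \sqrt z)$.\<close>
definition bessel :: "rat fps" where
  "bessel = Abs_fps (\<lambda>n. 1 / (fact n)\<^sup>2)"

definition bessel_theta :: "rat fps" where
  "bessel_theta = fps_X * fps_deriv bessel"

lemma bessel_ode: "fps_X * fps_deriv bessel_theta = fps_X * bessel"
proof (rule fps_ext)
  fix n
  show "fps_nth (fps_X * fps_deriv bessel_theta) n = fps_nth (fps_X * bessel) n"
    by (cases n) (simp_all add: bessel_theta_def bessel_def divide_simps power2_eq_square)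
qed

lemma xseq_eq_bessel_power:
  assumes "d > 0"
  shows "xseq d n = (fact n)\<^sup>2 * fps_nth (bessel ^ d) n"
proof -
  have set: "natpermute n d = {ns. length ns = d \<and> sum_list ns = n}" and int: "{0..d - 1} = {..<d}"
    using assms by (auto simp: natpermute_def)
  show ?thesis
    using assms unfolding xseq_def fps_power_nth set int
    by (simp add: bessel_def prod_dividef power_mult_distrib sum_distrib_left prod_power_distrib)
qed

definition sympow_basis :: "nat \<Rightarrow> nat \<Rightarrow> rat fps" where
  "sympow_basis d m = of_nat (\<Prod>i<m. d - i) * bessel ^ (d - m) * bessel_theta ^ m"

text \<open>
  Apply $\theta$ to $f^{d-m-1} g^{m+1}$ by the product rule, using $\theta f = g$ and
  $\theta g = z f$: the first factor yields the next basis element, the second one a multiple of the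
  previous element times $z$.
\<close>
lemma sympow_basis_Suc_Suc:
  "sympow_basis d (Suc (Suc m)) = fps_X * fps_deriv (sympow_basis d (Suc m))
     - fps_const (sympow_weight d (Suc m)) * fps_X * sympow_basis d m"
proof (cases "m < d")
  case False
  have "sympow_basis d n = 0" if "n > d" for n
  proof -
    have "(\<Prod>i<n. d - i) = 0" using that by auto
    then show ?thesis by (simp only: sympow_basis_def of_nat_0 mult_zero_left)
  qed
  then show ?thesis
    using False by (simp add: sympow_weight_def)
next
  case True
  then obtain e where d: "d = Suc (m + e)"
    by (metis less_iff_Suc_add)
  define C :: "rat fps" where "C = of_nat (\<Prod>i<m. d - i)"
  have C1: "of_nat (\<Prod>i<Suc m. d - i) = C * of_nat (Suc e)"
    and C2: "of_nat (\<Prod>i<Suc (Suc m). d - i) = C * of_nat (Suc e) * of_nat e"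
    by (simp_all add: C_def d distrib_left)
  have weight: "fps_const (sympow_weight d (Suc m)) = of_nat (Suc m) * of_nat (Suc e)"
    by (simp add: sympow_weight_def d algebra_simps flip: fps_of_nat)
  have deriv_C: "fps_deriv C = 0"
    by (simp add: C_def flip: fps_of_nat)
  have deriv_theta: "fps_deriv (bessel_theta ^ Suc m) = of_nat (Suc m) * fps_deriv bessel_theta * bessel_theta ^ m"
    by (simp only: fps_deriv_power' diff_Suc_1)
  have "fps_X * fps_deriv (C * of_nat (Suc e) * bessel ^ e * bessel_theta ^ Suc m)
      = C * of_nat (Suc e) * (of_nat e * bessel ^ (e - 1) * (fps_X * fps_deriv bessel) * bessel_theta ^ Suc m
          + bessel ^ e * (of_nat (Suc m) * bessel_theta ^ m * (fps_X * fps_deriv bessel_theta)))"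
    by (simp add: deriv_C fps_deriv_power'[of bessel] deriv_theta algebra_simps del: power_Suc of_nat_Suc)
  also have "\<dots> = C * of_nat (Suc e) * of_nat e * bessel ^ (e - 1) * bessel_theta ^ Suc (Suc m)
      + of_nat (Suc m) * of_nat (Suc e) * fps_X * (C * bessel ^ Suc e * bessel_theta ^ m)"
    unfolding bessel_ode bessel_theta_def[symmetric] by (simp add: algebra_simps)
  finally show ?thesis
    unfolding sympow_basis_def C1 C2 weight C_def[symmetric]
    by (simp add: d Suc_diff_le del: of_nat_Suc power_Suc)
qed

text \<open>The falling factorial in $G_{d+1}$ contains the factor $0$, so $L_{d+1} f^d = G_{d+1} = 0$.\<close>
lemma bessel_power_recurrence:
  "(\<Sum>i\<le>n. poly (continuant (sympow_weight d) (d + 1) i) (of_nat (n - i)) * fps_nth (bessel ^ d) (n - i)) = 0"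
proof -
  have "sympow_basis d 1 = fps_X * fps_deriv (sympow_basis d 0)"
    by (simp add: sympow_basis_def bessel_theta_def fps_deriv_power' algebra_simps)
  then have "fps_nth (sympow_basis d (d + 1)) n = (\<Sum>i\<le>n. poly (continuant (sympow_weight d) (d + 1) i)
      (of_nat (n - i)) * fps_nth (sympow_basis d 0) (n - i))"
    by (rule fps_nth_continuant_recurrence) (rule sympow_basis_Suc_Suc)
  then show ?thesis
    by (simp add: sympow_basis_def)
qed

section \<open>The recurrence and its coefficients\<close>

text \<open>
  Here \<open>i\<close> counts from the top of the recurrence, so that $Q_k$ has index $i = r - k$. The case
  $i = 0$ is $\theta^{d+1}$ divided by $\theta^2$.
\<close>
definition rec_coeff :: "nat \<Rightarrow> nat \<Rightarrow> rat poly" where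
  "rec_coeff d i = (if i = 0 then monom 1 (d - 1)
     else continuant (sympow_weight d) (d + 1) i * (\<Prod>j=1..i - 1. [:of_nat j, 1:] ^ 2))"

text \<open>
  Multiplying $y_n = x_n / (n!)^2$ by $((n+i)!)^2$ produces the factor
  $\prod_{j=1}^{i} (n+j)^2$, whose last term $(n+i)^2$ is common to all summands of the recurrence
  because they share the value of $n + i$.
\<close>
lemma rec_coeff_xseq:
  assumes "d > 0"
  shows "(of_nat (n + i))\<^sup>2 * (poly (rec_coeff d i) (of_nat n) * xseq d n)
    = (fact (n + i))\<^sup>2 * (poly (continuant (sympow_weight d) (d + 1) i) (of_nat n) * fps_nth (bessel ^ d) n)"
proof (cases i)
  case 0
  have "d + 1 = 2 + (d - 1)" using assms by simp
  then show ?thesis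
    unfolding xseq_eq_bessel_power[OF assms] 0 continuant_0 poly_monom rec_coeff_def
    by (simp only: power_add if_True) (simp add: poly_monom)
next
  case (Suc i')
  have "fact (n + i') = fact n * (\<Prod>j=1..i'. of_nat n + of_nat j :: rat)"
    by (induction i') (simp_all add: algebra_simps)
  then have "fact (n + i) = of_nat (n + i) * (fact n * (\<Prod>j=1..i'. of_nat n + of_nat j :: rat))"
    by (simp add: Suc)
  then show ?thesis
    unfolding xseq_eq_bessel_power[OF assms] rec_coeff_def
    by (simp add: Suc poly_prod poly_power power_mult_distrib prod_power_distrib add.commute mult_ac
        del: continuant.simps of_nat_Suc of_nat_add)
qed

text \<open>
  The truncation at \<open>n\<close> covers the initial conditions as well: for $n < r$ the missing terms are
  those with a negative index.
\<close>
lemma xseq_recurrence: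
  assumes "d > 0" "n > 0"
  shows "(\<Sum>i\<le>min ((d + 1) div 2) n. poly (rec_coeff d i) (of_nat (n - i)) * xseq d (n - i)) = 0"
proof -
  let ?L = "continuant (sympow_weight d) (d + 1)"
  have "(of_nat n)\<^sup>2 * (\<Sum>i\<le>min ((d + 1) div 2) n. poly (rec_coeff d i) (of_nat (n - i)) * xseq d (n - i))
     = (\<Sum>i\<le>min ((d + 1) div 2) n. (fact n)\<^sup>2 * (poly (?L i) (of_nat (n - i)) * fps_nth (bessel ^ d) (n - i)))"
    unfolding sum_distrib_left
  proof (intro sum.cong refl)
    fix i assume "i \<in> {..min ((d + 1) div 2) n}"
    then show "(of_nat n)\<^sup>2 * (poly (rec_coeff d i) (of_nat (n - i)) * xseq d (n - i))
        = (fact n)\<^sup>2 * (poly (?L i) (of_nat (n - i)) * fps_nth (bessel ^ d) (n - i))"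
      using rec_coeff_xseq[OF assms(1), of "n - i" i] by simp
  qed
  also have "\<dots> = (\<Sum>i\<le>n. (fact n)\<^sup>2 * (poly (?L i) (of_nat (n - i)) * fps_nth (bessel ^ d) (n - i)))"
    by (intro sum.mono_neutral_left) (auto simp: continuant_eq_0)
  also have "\<dots> = 0"
    unfolding sum_distrib_left[symmetric] bessel_power_recurrence by simp
  finally show ?thesis using assms by simp
qed

lemma degree_linear_squares:
  "degree (\<Prod>j=1..n. [:of_nat j, 1 :: rat:] ^ 2) = 2 * n"
  by (subst degree_prod_eq_sum_degree) (simp_all add: degree_power_eq)

lemma lead_coeff_linear_squares:
  "lead_coeff (\<Prod>j=1..n. [:of_nat j, 1 :: rat:] ^ 2) = 1"
  by (simp add: lead_coeff_prod lead_coeff_power)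

lemma degree_rec_coeff:
  assumes "d \<ge> 2" "i \<le> (d + 1) div 2"
  shows "degree (rec_coeff d i) = d - 1"
proof (cases "i = 0")
  case False
  have nz: "continuant (sympow_weight d) (d + 1) i \<noteq> 0"
    using coeff_sympow_top[OF assms(2)] elem_sym_Sset_pos[OF assms(2)] by auto
  have nz': "(\<Prod>j=1..i - 1. [:of_nat j, 1 :: rat:] ^ 2) \<noteq> 0"
    by simp
  have "degree (rec_coeff d i) = (d + 1 - 2 * i) + 2 * (i - 1)"
    using False by (simp only: rec_coeff_def degree_mult_eq[OF nz nz'] degree_linear_squares degree_sympow[OF assms(2)] if_False)
  then show ?thesis using False assms by auto
qed (simp add: rec_coeff_def degree_monom_eq)

lemma lead_coeff_rec_coeff:
  assumes "i \<le> (d + 1) div 2"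
  shows "lead_coeff (rec_coeff d i) = (- 1) ^ i * of_nat (elem_sym i (Sset d))"
proof (cases "i = 0")
  case True
  have "{B. B \<subseteq> Sset d \<and> card B = 0} = {{}}"
    using finite_Sset by (auto dest: finite_subset)
  then show ?thesis
    by (simp add: True rec_coeff_def degree_monom_eq elem_sym_def)
next
  case False
  then show ?thesis
    using coeff_sympow_top[OF assms]
    by (simp only: rec_coeff_def lead_coeff_mult lead_coeff_linear_squares degree_sympow[OF assms] if_False mult_1_right)
qed

text \<open>The substitution $t \mapsto -t-i$ sends $t + j$ to $-(t + (i - j))$ and so permutes the squares.\<close>
lemma rec_coeff_reflect:
  assumes "d \<ge> 2"
  shows "poly (rec_coeff d i) (- t - of_nat i) = (- 1) ^ (d - 1) * poly (rec_coeff d i) t"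
proof (cases "i = 0")
  case True
  then show ?thesis by (simp add: rec_coeff_def poly_monom power_minus[of t])
next
  case False
  have sign: "(- 1 :: rat) ^ (d + 1) = (- 1) ^ (d - 1)"
    using assms by (cases d) simp_all
  have "(\<Prod>j=1..i - 1. (of_nat j + (- t - of_nat i))\<^sup>2) = (\<Prod>j=1..i - 1. (of_nat j + t)\<^sup>2)"
  proof (rule prod.reindex_bij_witness[of _ "\<lambda>j. i - j" "\<lambda>j. i - j"])
    fix j assume j: "j \<in> {1..i - 1}"
    then have "j \<le> i" by auto
    then have "of_nat (i - j) + t = - (of_nat j + (- t - of_nat i))"
      by (simp add: of_nat_diff)
    then show "(of_nat (i - j) + t)\<^sup>2 = (of_nat j + (- t - of_nat i))\<^sup>2"
      by (simp only: power2_minus)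
  qed (use False in auto)
  then show ?thesis
    using False by (simp only: rec_coeff_def if_False poly_mult poly_sympow_reflect sign)
      (simp add: poly_prod poly_power)
qed

lemma poly_linear_squares:
  "poly (\<Prod>j=1..n. [:of_nat j, 1:] ^ 2) t = (\<Prod>j=1..n. (t + of_nat j)\<^sup>2)" for t :: rat
  by (simp add: poly_prod poly_power add.commute)

lemma continuant_last_odd:
  assumes "odd d" and "r = (d + 1) div 2"
  shows "poly (continuant (sympow_weight d) (d + 1) r) t = (- 1) ^ r * of_nat (elem_sym r (Sset d))"
proof -
  have "d + 1 - 2 * r = 0" using assms by simp
  then have "degree (continuant (sympow_weight d) (d + 1) r) = 0"
    and "poly.coeff (continuant (sympow_weight d) (d + 1) r) 0 = (- 1) ^ r * of_nat (elem_sym r (Sset d))"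
    using degree_sympow[of r d] coeff_sympow_top[of r d] assms(2) by simp_all
  then show ?thesis
    by (elim degree_eq_zeroE) simp
qed

text \<open>A linear polynomial that is odd under $t \mapsto -t-r$ vanishes at the fixed point $-r/2$.\<close>
lemma continuant_last_even:
  assumes "even d" and "r = (d + 1) div 2"
  shows "poly (continuant (sympow_weight d) (d + 1) r) t
    = (- 1) ^ r * of_nat (elem_sym r (Sset d)) * (t + of_nat r / 2)"
proof -
  let ?p = "continuant (sympow_weight d) (d + 1) r"
  have "d + 1 - 2 * r = 1" using assms by auto
  then have deg: "degree ?p = 1"
    and lead: "poly.coeff ?p 1 = (- 1) ^ r * of_nat (elem_sym r (Sset d))"
    using degree_sympow[of r d] coeff_sympow_top[of r d] assms(2) by simp_all
  have p: "?p = [:poly.coeff ?p 0, poly.coeff ?p 1:]"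
    using deg by (intro poly_eqI) (auto simp: coeff_pCons coeff_eq_0 split: nat.split)
  have eval: "poly ?p z = poly.coeff ?p 0 + poly.coeff ?p 1 * z" for z
    by (subst p) (simp add: mult.commute)
  have "poly ?p (- 0 - of_nat r) = - poly ?p 0"
    unfolding poly_sympow_reflect using assms(1) by simp
  then have "poly.coeff ?p 0 = poly.coeff ?p 1 * (of_nat r / 2)"
    unfolding eval by simp
  then show ?thesis
    unfolding eval lead by (simp add: algebra_simps)
qed

theorem proposition3:
  fixes d r :: nat
  assumes "d \<ge> 2" and "r = (d + 1) div 2"
  shows "\<exists>Q :: nat \<Rightarrow> rat poly.
    (\<forall>n. (\<Sum>k=0..r. poly (Q k) (of_nat (n + k)) * xseq d (n + k)) = 0) \<and>
    (\<forall>m\<le>r - 1. (\<Sum>k=0..m. poly (Q (r - m + k)) (of_nat k) * xseq d k) = 0) \<and>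
    (\<forall>k\<le>r. degree (Q k) = d - 1) \<and>
    (\<forall>k\<le>r. \<forall>n. poly (Q k) (- n - of_nat r + of_nat k) = (- 1) ^ (d - 1) * poly (Q k) n) \<and>
    (\<forall>k\<le>r. lead_coeff (Q k) = (- 1) ^ (r - k) * of_nat (elem_sym (r - k) (Sset d))) \<and>
    (\<forall>n. poly (Q r) n = n ^ (d - 1)) \<and>
    (\<forall>k. k + 2 \<le> r \<longrightarrow> (\<Prod>j=1..r - k - 1. [:of_nat j, 1:] ^ 2) dvd Q k) \<and>
    (odd d \<longrightarrow> (\<forall>n. poly (Q 0) n =
       (- 1) ^ r * of_nat (elem_sym r (Sset d)) * (\<Prod>j=1..r - 1. (n + of_nat j) ^ 2))) \<and>
    (even d \<longrightarrow> (\<forall>n. poly (Q 0) n =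
       (- 1) ^ r * of_nat (elem_sym r (Sset d)) * (n + of_nat r / 2) * (\<Prod>j=1..r - 1. (n + of_nat j) ^ 2))) \<and>
    (\<forall>n. poly (Q (r - 1)) n =
       - (\<Sum>j=0..d - 1. (of_nat d - of_nat j) * of_nat ((d + 2) choose j) * n ^ j)) \<and>
    (\<forall>n. poly (Q (r - 1)) n =
       - ((n + 1) ^ (d + 1) * (of_nat d - 2 * n) + n ^ (d + 1) * (of_nat d + 2 + 2 * n)))"
proof (intro exI[of _ "\<lambda>k. rec_coeff d (r - k)"] conjI allI impI)
  have r: "r \<ge> 1" using assms by simp
  have d: "d > 0" using assms by simp
  show "(\<Sum>k=0..r. poly (rec_coeff d (r - k)) (of_nat (n + k)) * xseq d (n + k)) = 0" for n
  proof -
    have "(\<Sum>k=0..r. poly (rec_coeff d (r - k)) (of_nat (n + k)) * xseq d (n + k))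
        = (\<Sum>i\<le>min r (n + r). poly (rec_coeff d i) (of_nat (n + r - i)) * xseq d (n + r - i))"
      by (rule sum.reindex_bij_witness[of _ "\<lambda>i. r - i" "\<lambda>k. r - k"]) auto
    also have "\<dots> = 0"
      using xseq_recurrence[OF d, of "n + r"] r unfolding assms(2)[symmetric] by simp
    finally show ?thesis .
  qed
  show "(\<Sum>k=0..m. poly (rec_coeff d (r - (r - m + k))) (of_nat k) * xseq d k) = 0" if "m \<le> r - 1" for m
  \<comment> \<open>At $m = 0$ dividing by $m^2$ is impossible; the condition is $Q_r(0) = 0$, true as $d \ge 2$.\<close>
  proof (cases "m = 0")
    case True
    then show ?thesis using assms(1) by (simp add: rec_coeff_def poly_monom)
  next
    case False
    have "(\<Sum>k=0..m. poly (rec_coeff d (r - (r - m + k))) (of_nat k) * xseq d k)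
        = (\<Sum>i\<le>min r m. poly (rec_coeff d i) (of_nat (m - i)) * xseq d (m - i))"
      by (rule sum.reindex_bij_witness[of _ "\<lambda>i. m - i" "\<lambda>k. m - k"]) (use that in auto)
    also have "\<dots> = 0"
      using xseq_recurrence[OF d, of m] False unfolding assms(2)[symmetric] by simp
    finally show ?thesis .
  qed
  show "degree (rec_coeff d (r - k)) = d - 1" if "k \<le> r" for k
    using assms by (intro degree_rec_coeff) auto
  show "poly (rec_coeff d (r - k)) (- n - of_nat r + of_nat k)
      = (- 1) ^ (d - 1) * poly (rec_coeff d (r - k)) n" if "k \<le> r" for k n
    using rec_coeff_reflect[OF assms(1), of "r - k" n] that by (simp add: of_nat_diff algebra_simps)
  show "lead_coeff (rec_coeff d (r - k)) = (- 1) ^ (r - k) * of_nat (elem_sym (r - k) (Sset d))"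
    if "k \<le> r" for k
    using assms by (intro lead_coeff_rec_coeff) auto
  show "poly (rec_coeff d (r - r)) n = n ^ (d - 1)" for n
    by (simp add: rec_coeff_def poly_monom)
  show "(\<Prod>j=1..r - k - 1. [:of_nat j, 1:] ^ 2) dvd rec_coeff d (r - k)" if "k + 2 \<le> r" for k
    using that by (simp only: rec_coeff_def if_False dvd_triv_right split: if_split) simp
  show "poly (rec_coeff d (r - 0)) n
      = (- 1) ^ r * of_nat (elem_sym r (Sset d)) * (\<Prod>j=1..r - 1. (n + of_nat j) ^ 2)" if "odd d" for n
    using r by (simp only: rec_coeff_def poly_mult poly_linear_squares diff_zero
      continuant_last_odd[OF that assms(2)] split: if_split) simp
  show "poly (rec_coeff d (r - 0)) n = (- 1) ^ r * of_nat (elem_sym r (Sset d)) * (n + of_nat r / 2)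
      * (\<Prod>j=1..r - 1. (n + of_nat j) ^ 2)" if "even d" for n
    using r by (simp only: rec_coeff_def poly_mult poly_linear_squares diff_zero
      continuant_last_even[OF that assms(2)] split: if_split) simp
  have "r - (r - 1) = 1" using r by simp
  then have closed: "poly (rec_coeff d (r - (r - 1))) n
      = - ((n + 1) ^ (d + 1) * (of_nat d - 2 * n) + n ^ (d + 1) * (of_nat d + 2 + 2 * n))" for n
    by (simp only: rec_coeff_def poly_mult poly_sympow_1_closed one_neq_zero if_False) simp
  then show "poly (rec_coeff d (r - (r - 1))) n
      = - ((n + 1) ^ (d + 1) * (of_nat d - 2 * n) + n ^ (d + 1) * (of_nat d + 2 + 2 * n))" for n .
  show "poly (rec_coeff d (r - (r - 1))) n
      = - (\<Sum>j=0..d - 1. (of_nat d - of_nat j) * of_nat ((d + 2) choose j) * n ^ j)" for n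
    unfolding sum_shifted_binomial_closed by (rule closed)
qed

end
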